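(* Let $\mathcal M_d=(Q,H_d,\phi_d)$ be a regular forced discrete Hamiltonian system, with discrete flow $\mathbf F^{\mathcal M_d}=(\mathbb F^+_{\phi_d}H_d)\circ(\mathbb F^-_{\phi_d}H_d)^{-1}$. Then the evolution of the canonical symplectic form $\omega_Q$ of $T^*Q$ is given by $$(\mathbf F^{\mathcal M_d})^*(\omega_Q)=\omega_Q-\big((\mathbb F^-_{\phi_d}H_d)^{-1}\big)^*(d\phi_d).$$
   Context: $Q$ is a finite-dimensional real vector space and $T^*Q\simeq Q\times Q^*$; $\omega_Q=dq^i\wedge dp_i$ is the canonical symplectic form in linear coordinates. A forced discrete Hamiltonian system (FDHS) is a triple $(Q,H_d,\phi_d)$ with $H_d:T^*Q\to\mathbb R$ smooth and $\phi_d$ a smooth 1-form on $T^*Q$, decomposed as $\phi_d(q,p)(\delta q,\delta p)=\phi_d^q(q,p)(\delta q)+\phi_d^p(q,p)(\delta p)$. Its forced discrete Legendre transforms $T^*Q\to T^*Q$ are $$\mathbb F^+_{\phi_d}H_d(q_0,p_1)=(D_2H_d(q_0,p_1)-\phi_d^p(q_0,p_1),\,p_1),\qquad \mathbb F^-_{\phi_d}H_d(q_0,p_1)=(q_0,\,D_1H_d(q_0,p_1)-\phi_d^q(q_0,p_1)).$$ The FDHS is regular if both transforms are local diffeomorphisms. The discrete flow is understood locally: whenever $U,V,W\subset T^*Q$ are open and $\mathbb F^-_{\phi_d}H_d|_W:W\to U$ and $\mathbb F^+_{\phi_d}H_d|_W:W\to V$ are diffeomorphisms, $\mathbf F^{\mathcal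 M_d}:U\to V$ is $\mathbf F^{\mathcal M_d}=(\mathbb F^+_{\phi_d}H_d|_W)\circ(\mathbb F^-_{\phi_d}H_d|_W)^{-1}$, and $(\mathbb F^-_{\phi_d}H_d)^{-1}$ in the formula denotes this same local inverse $U\to W$; the identity is between 2-forms on $U$. *)

theory Defs
  imports "HOL-Analysis.Analysis"
begin

section \<open>Smooth maps, local diffeomorphisms, forms on open subsets of vector spaces\<close>

text \<open>
  On an open subset of a finite-dimensional space, a map is of class \<open>C\<^sup>n\<^sup>+\<^sup>1\<close> iff it is
  differentiable and all its directional derivatives are of class \<open>C\<^sup>n\<close>. Phrasing the recursion
  through directional derivatives keeps the codomain type fixed. The derivatives are the full ones
  (\<open>at x\<close>), so these notions are meant for open sets only.
\<close>

fun Ck_on :: "nat \<Rightarrow> 'a::real_normed_vector set \<Rightarrow> ('a \<Rightarrow> 'b::real_normed_vector) \<Rightarrow> bool" where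
  "Ck_on 0 S f \<longleftrightarrow> continuous_on S f"
| "Ck_on (Suc n) S f \<longleftrightarrow> (\<forall>x\<in>S. f differentiable (at x)) \<and>
     (\<forall>v. Ck_on n S (\<lambda>x. frechet_derivative f (at x) v))"

definition smooth_on :: "'a::real_normed_vector set \<Rightarrow> ('a \<Rightarrow> 'b::real_normed_vector) \<Rightarrow> bool" where
  "smooth_on S f \<longleftrightarrow> (\<forall>n. Ck_on n S f)"

definition diffeomorphism_on ::
  "'a::real_normed_vector set \<Rightarrow> 'b::real_normed_vector set \<Rightarrow> ('a \<Rightarrow> 'b) \<Rightarrow> bool" where
  "diffeomorphism_on S T f \<longleftrightarrow> open S \<and> open T \<and> bij_betw f S T \<and>
     smooth_on S f \<and> smooth_on T (inv_into S f)"

definition local_diffeomorphism :: "('a::real_normed_vector \<Rightarrow> 'b::real_normed_vector) \<Rightarrow> bool" where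
  "local_diffeomorphism f \<longleftrightarrow> (\<forall>x. \<exists>S T. x \<in> S \<and> diffeomorphism_on S T f)"

type_synonym 'z one_form = "'z \<Rightarrow> ('z \<Rightarrow>\<^sub>L real)"
type_synonym 'z two_form = "'z \<Rightarrow> 'z \<Rightarrow> 'z \<Rightarrow> real"

text \<open>The usual formula \<open>d\<theta>(X,Y) = X(\<theta>(Y)) - Y(\<theta>(X)) - \<theta>([X,Y])\<close> for constant vector
  fields \<open>X = u\<close>, \<open>Y = v\<close>, whose bracket vanishes.\<close>

definition ext_deriv :: "'z::real_normed_vector one_form \<Rightarrow> 'z two_form" where
  "ext_deriv \<theta> x u v =
     blinfun_apply (frechet_derivative \<theta> (at x) u) v - blinfun_apply (frechet_derivative \<theta> (at x) v) u"

definition pullback ::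
  "('y::real_normed_vector \<Rightarrow> 'z::real_normed_vector) \<Rightarrow> 'z two_form \<Rightarrow> 'y two_form" where
  "pullback F \<omega> x u v = \<omega> (F x) (frechet_derivative F (at x) u) (frechet_derivative F (at x) v)"


section \<open>The cotangent bundle of a vector space\<close>

text \<open>
  The configuration space is a type \<open>'q\<close> of class \<open>real_normed_vector\<close>, required to be
  finite-dimensional in \<open>FDHS\<close> below. All norms on it are equivalent and all its linear
  functionals are bounded, so \<open>'q \<Rightarrow>\<^sub>L real\<close> is the full linear dual and nothing below depends
  on the norm.
\<close>

type_synonym 'q cotangent = "'q \<times> ('q \<Rightarrow>\<^sub>L real)"

definition canonical_symplectic_form :: "'q::real_normed_vector cotangent two_form" where
  "canonical_symplectic_form z u v = blinfun_apply (snd v) (fst u) - blinfun_apply (snd u) (fst v)"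

definition bidual_embedding :: "'q::real_normed_vector \<Rightarrow> (('q \<Rightarrow>\<^sub>L real) \<Rightarrow>\<^sub>L real)" where
  "bidual_embedding x = Blinfun (\<lambda>\<alpha>. blinfun_apply \<alpha> x)"

text \<open>The canonical identification of the bidual with \<open>Q\<close>; see \<open>bij_bidual_embedding\<close>.\<close>

definition from_bidual :: "(('q::real_normed_vector \<Rightarrow>\<^sub>L real) \<Rightarrow>\<^sub>L real) \<Rightarrow> 'q" where
  "from_bidual = inv bidual_embedding"

lemma bidual_embedding_apply [simp]:
  "blinfun_apply (bidual_embedding x) \<alpha> = blinfun_apply \<alpha> x"
  unfolding bidual_embedding_def
  by (subst bounded_linear_Blinfun_apply)
    (auto intro: bounded_linear_intros bounded_linear_blinfun_apply)


section \<open>Forced discrete Hamiltonian systems\<close>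

definition FDHS ::
  "('q::real_normed_vector cotangent \<Rightarrow> real) \<Rightarrow> 'q cotangent one_form \<Rightarrow> bool" where
  "FDHS H \<phi> \<longleftrightarrow> (\<exists>B::'q set. finite_dimensional_vector_space (*\<^sub>R) B) \<and>
     smooth_on UNIV H \<and> smooth_on UNIV \<phi>"

definition force_q :: "'q::real_normed_vector cotangent one_form \<Rightarrow> 'q cotangent \<Rightarrow> ('q \<Rightarrow>\<^sub>L real)" where
  "force_q \<phi> z = Blinfun (\<lambda>\<delta>q. blinfun_apply (\<phi> z) (\<delta>q, 0))"

definition force_p ::
  "'q::real_normed_vector cotangent one_form \<Rightarrow> 'q cotangent \<Rightarrow> (('q \<Rightarrow>\<^sub>L real) \<Rightarrow>\<^sub>L real)" where
  "force_p \<phi> z = Blinfun (\<lambda>\<delta>p. blinfun_apply (\<phi> z) (0, \<delta>p))"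

definition partial_D1 :: "('q::real_normed_vector cotangent \<Rightarrow> real) \<Rightarrow> 'q cotangent \<Rightarrow> ('q \<Rightarrow>\<^sub>L real)" where
  "partial_D1 H z = Blinfun (frechet_derivative (\<lambda>q. H (q, snd z)) (at (fst z)))"

definition partial_D2 ::
  "('q::real_normed_vector cotangent \<Rightarrow> real) \<Rightarrow> 'q cotangent \<Rightarrow> (('q \<Rightarrow>\<^sub>L real) \<Rightarrow>\<^sub>L real)" where
  "partial_D2 H z = Blinfun (frechet_derivative (\<lambda>p. H (fst z, p)) (at (snd z)))"

definition legendre_plus ::
  "('q::real_normed_vector cotangent \<Rightarrow> real) \<Rightarrow> 'q cotangent one_form \<Rightarrow> 'q cotangent \<Rightarrow> 'q cotangent" where
  "legendre_plus H \<phi> z = (from_bidual (partial_D2 H z - force_p \<phi> z), snd z)"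

definition legendre_minus ::
  "('q::real_normed_vector cotangent \<Rightarrow> real) \<Rightarrow> 'q cotangent one_form \<Rightarrow> 'q cotangent \<Rightarrow> 'q cotangent" where
  "legendre_minus H \<phi> z = (fst z, partial_D1 H z - force_q \<phi> z)"

definition regular_FDHS ::
  "('q::real_normed_vector cotangent \<Rightarrow> real) \<Rightarrow> 'q cotangent one_form \<Rightarrow> bool" where
  "regular_FDHS H \<phi> \<longleftrightarrow> FDHS H \<phi> \<and>
     local_diffeomorphism (legendre_plus H \<phi>) \<and> local_diffeomorphism (legendre_minus H \<phi>)"

text \<open>The flow is local: it depends on an open set \<open>W\<close> that both Legendre transforms map
  diffeomorphically onto open sets, and it is meaningful on the image of \<open>W\<close> under
  \<open>legendre_minus H \<phi>\<close>.\<close>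

definition discrete_flow ::
  "('q::real_normed_vector cotangent \<Rightarrow> real) \<Rightarrow> 'q cotangent one_form \<Rightarrow> 'q cotangent set \<Rightarrow>
   'q cotangent \<Rightarrow> 'q cotangent" where
  "discrete_flow H \<phi> W = legendre_plus H \<phi> \<circ> inv_into W (legendre_minus H \<phi>)"


section \<open>The identifications are the intended ones\<close>

text \<open>On a finite-dimensional normed space coordinates, hence all linear functionals, are bounded.\<close>

lemma coordinates_bounded:
  fixes B :: "'q::real_normed_vector set"
  assumes "finite B" "independent B"
  shows "\<exists>C>0. \<forall>a. (\<Sum>b\<in>B. \<bar>a b\<bar>) \<le> C * norm (\<Sum>b\<in>B. a b *\<^sub>R b)"
  using assms
proof (induction B rule: finite_induct)
  case empty
  show ?case by (auto intro: exI[of _ 1])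
next
  case (insert b B)
  have indB: "independent B" and b: "b \<notin> span B"
    using insert.prems insert.hyps by (auto simp: independent_insert)
  obtain C where C: "C > 0" "\<And>a. (\<Sum>b\<in>B. \<bar>a b\<bar>) \<le> C * norm (\<Sum>b\<in>B. a b *\<^sub>R b)"
    using insert.IH[OF indB] by blast
  define s where "s a = (\<Sum>b\<in>B. a b *\<^sub>R b)" for a :: "'q \<Rightarrow> real"
  have "\<exists>d>0. \<forall>a. d \<le> norm (b - s a)"
  proof (rule ccontr)
    assume "\<not> ?thesis"
    then have "\<forall>n::nat. \<exists>a. norm (b - s a) < inverse (real (Suc n))"
      by (meson inverse_positive_iff_positive not_le of_nat_0_less_iff zero_less_Suc)
    then obtain a where a: "\<And>n. norm (b - s (a n)) < inverse (real (Suc n))" by metis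
    have lim: "(\<lambda>n. s (a n)) \<longlonglongrightarrow> b"
    proof (rule Lim_transform_bound[OF _ LIMSEQ_inverse_real_of_nat, THEN Lim_null[THEN iffD2]])
      show "\<forall>\<^sub>F n in sequentially. norm (s (a n) - b) \<le> norm (inverse (real (Suc n)))"
        using a by (intro always_eventually allI)
          (simp add: norm_minus_commute less_imp_le del: of_nat_Suc)
    qed
    then have cs: "Cauchy (\<lambda>n. s (a n))" by (intro LIMSEQ_imp_Cauchy)
    have "Cauchy (\<lambda>n. a n c)" if "c \<in> B" for c
    proof (rule metric_CauchyI)
      fix e :: real assume "e > 0"
      then obtain M where M: "\<And>m n. m \<ge> M \<Longrightarrow> n \<ge> M \<Longrightarrow> dist (s (a m)) (s (a n)) < e / C"
        using metric_CauchyD[OF cs, of "e / C"] C(1) by auto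
      show "\<exists>M. \<forall>m\<ge>M. \<forall>n\<ge>M. dist (a m c) (a n c) < e"
      proof (intro exI allI impI)
        fix m n assume mn: "m \<ge> M" "n \<ge> M"
        have "\<bar>a m c - a n c\<bar> \<le> (\<Sum>b\<in>B. \<bar>a m b - a n b\<bar>)"
          using that insert.hyps(1) by (intro member_le_sum) auto
        also have "\<dots> \<le> C * norm (s (a m) - s (a n))"
          using C(2)[of "\<lambda>b. a m b - a n b"] by (simp add: s_def scaleR_diff_left sum_subtractf)
        also have "\<dots> < e"
          using M[OF mn] C(1) by (simp add: dist_norm field_simps)
        finally show "dist (a m c) (a n c) < e" by (simp add: dist_real_def)
      qed
    qed
    then have "\<forall>c\<in>B. \<exists>l. (\<lambda>n. a n c) \<longlonglongrightarrow> l"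
      by (auto simp: Cauchy_convergent_iff convergent_def)
    then obtain l where "\<And>c. c \<in> B \<Longrightarrow> (\<lambda>n. a n c) \<longlonglongrightarrow> l c" by metis
    then have "(\<lambda>n. s (a n)) \<longlonglongrightarrow> s l"
      unfolding s_def by (intro tendsto_sum tendsto_scaleR) auto
    with lim have "b = s l" by (rule LIMSEQ_unique)
    then show False
      using b by (auto simp: s_def intro: span_sum span_scale span_base)
  qed
  then obtain d where d: "d > 0" "\<And>a. d \<le> norm (b - s a)" by blast
  have dist_b: "d * \<bar>t\<bar> \<le> norm (t *\<^sub>R b + s a)" for t a
  proof (cases "t = 0")
    case False
    have "t *\<^sub>R b + s a = t *\<^sub>R (b - s (\<lambda>c. - a c / t))"
      using False by (simp add: s_def scaleR_diff_right scaleR_add_right scaleR_sum_right sum_negf)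
    then have "norm (t *\<^sub>R b + s a) = \<bar>t\<bar> * norm (b - s (\<lambda>c. - a c / t))"
      by simp
    then show ?thesis
      using mult_left_mono[OF d(2) abs_ge_zero] by (simp add: mult.commute)
  qed simp
  define K where "K = C + (1 + C * norm b) / d"
  have "(\<Sum>c\<in>insert b B. \<bar>a c\<bar>) \<le> K * norm (\<Sum>c\<in>insert b B. a c *\<^sub>R c)" for a
  proof -
    let ?x = "a b *\<^sub>R b + s a"
    have t: "\<bar>a b\<bar> \<le> norm ?x / d"
      using dist_b[of "a b" a] d(1) by (simp add: field_simps)
    have "norm (s a) \<le> norm ?x + \<bar>a b\<bar> * norm b"
      using norm_triangle_ineq4[of ?x "a b *\<^sub>R b"] by simp
    then have "\<bar>a b\<bar> + C * norm (s a) \<le> C * norm ?x + \<bar>a b\<bar> * (1 + C * norm b)"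
      using mult_left_mono[of "norm (s a)" "norm ?x + \<bar>a b\<bar> * norm b" C] C(1)
      by (simp add: algebra_simps)
    also have "\<dots> \<le> C * norm ?x + norm ?x / d * (1 + C * norm b)"
      using t C(1) by (intro add_left_mono mult_right_mono) auto
    also have "\<dots> = K * norm ?x" by (simp add: K_def algebra_simps add_divide_distrib)
    finally show ?thesis
      using insert.hyps C(2)[of a] by (simp add: s_def)
  qed
  moreover have "K > 0"
    using C(1) d(1) by (auto simp: K_def intro!: add_pos_nonneg divide_nonneg_pos)
  ultimately show ?case by blast
qed

lemma basis_expansion:
  fixes B :: "'q::real_normed_vector set"
  assumes "finite_dimensional_vector_space (*\<^sub>R) B"
  shows "x = (\<Sum>b\<in>B. representation B x b *\<^sub>R b)"
proof -
  interpret fd: finite_dimensional_vector_space "(*\<^sub>R)" B by fact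
  show ?thesis
    using sum_representation_eq[of B x B] fd.independent_Basis fd.span_Basis fd.finite_Basis
    by (simp add: span_raw_def dependent_raw_def)
qed

lemma finite_dim_functional_bounded:
  fixes B :: "'q::real_normed_vector set" and f :: "'q \<Rightarrow> real"
  assumes B: "finite_dimensional_vector_space (*\<^sub>R) B" and f: "linear f"
  shows "bounded_linear f"
proof -
  interpret fd: finite_dimensional_vector_space "(*\<^sub>R)" B by fact
  obtain C where C: "C > 0" "\<And>a. (\<Sum>b\<in>B. \<bar>a b\<bar>) \<le> C * norm (\<Sum>b\<in>B. a b *\<^sub>R b)"
    using coordinates_bounded[of B] fd.finite_Basis fd.independent_Basis
    by (auto simp: dependent_raw_def)
  define M where "M = (\<Sum>b\<in>B. \<bar>f b\<bar>)"
  have "norm (f x) \<le> norm x * (C * M)" for x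
  proof -
    let ?r = "representation B x"
    have "f x = (\<Sum>b\<in>B. ?r b * f b)"
      using arg_cong[OF basis_expansion[OF B, of x], of f] f
      by (simp add: linear_sum linear_scale)
    also have "\<bar>\<dots>\<bar> \<le> (\<Sum>b\<in>B. \<bar>?r b\<bar> * M)"
      unfolding M_def using fd.finite_Basis
      by (intro order.trans[OF sum_abs] sum_mono) (auto simp: abs_mult intro!: mult_left_mono member_le_sum)
    also have "\<dots> = (\<Sum>b\<in>B. \<bar>?r b\<bar>) * M" by (simp add: sum_distrib_right)
    also have "\<dots> \<le> (C * norm x) * M"
      using C(2)[of ?r] basis_expansion[OF B, of x]
      by (intro mult_right_mono) (auto simp: M_def intro: sum_nonneg)
    finally show ?thesis by (simp add: mult_ac)
  qed
  with f show ?thesis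
    by (intro bounded_linear.intro bounded_linear_axioms.intro) auto
qed

lemma bij_bidual_embedding:
  fixes B :: "'q::real_normed_vector set"
  assumes B: "finite_dimensional_vector_space (*\<^sub>R) B"
  shows "bij (bidual_embedding :: 'q \<Rightarrow> _)"
proof -
  interpret fd: finite_dimensional_vector_space "(*\<^sub>R)" B by fact
  have ind: "independent B" and sp: "span B = UNIV"
    using fd.independent_Basis fd.span_Basis by (auto simp: dependent_raw_def span_raw_def)
  define c where "c b = Blinfun (\<lambda>x. representation B x b)" for b
  have c: "blinfun_apply (c b) x = representation B x b" for b x
  proof -
    have "linear (\<lambda>x. representation B x b)"
      using ind sp by (intro linearI) (auto simp: representation_add representation_scale)
    then show ?thesis
      unfolding c_def by (simp add: bounded_linear_Blinfun_apply finite_dim_functional_bounded[OF B])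
  qed
  show ?thesis
  proof (rule bijI)
    show "inj (bidual_embedding :: 'q \<Rightarrow> _)"
    proof (rule injI)
      fix x y :: 'q assume "bidual_embedding x = bidual_embedding y"
      then have "representation B x b = representation B y b" for b
        by (metis bidual_embedding_apply c)
      then show "x = y" by (metis (no_types, lifting) ext basis_expansion[OF B])
    qed
    show "surj (bidual_embedding :: 'q \<Rightarrow> _)"
    proof (rule surjI)
      fix \<xi> :: "('q \<Rightarrow>\<^sub>L real) \<Rightarrow>\<^sub>L real"
      show "bidual_embedding (\<Sum>b\<in>B. blinfun_apply \<xi> (c b) *\<^sub>R b) = \<xi>"
      proof (rule blinfun_eqI)
        fix \<alpha> :: "'q \<Rightarrow>\<^sub>L real"
        have "\<alpha> = (\<Sum>b\<in>B. blinfun_apply \<alpha> b *\<^sub>R c b)"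
        proof (rule blinfun_eqI)
          fix x
          show "blinfun_apply \<alpha> x = blinfun_apply (\<Sum>b\<in>B. blinfun_apply \<alpha> b *\<^sub>R c b) x"
            using arg_cong[OF basis_expansion[OF B, of x], of "blinfun_apply \<alpha>"]
            by (simp add: blinfun.sum_right blinfun.sum_left blinfun.scaleR_right blinfun.scaleR_left c mult.commute)
        qed
        then have "blinfun_apply \<xi> \<alpha> = blinfun_apply \<xi> (\<Sum>b\<in>B. blinfun_apply \<alpha> b *\<^sub>R c b)" by simp
        then show "blinfun_apply (bidual_embedding (\<Sum>b\<in>B. blinfun_apply \<xi> (c b) *\<^sub>R b)) \<alpha> = blinfun_apply \<xi> \<alpha>"
          by (simp add: blinfun.sum_right blinfun.scaleR_right mult.commute)
      qed
    qed
  qed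
qed

text \<open>In linear coordinates, \<open>canonical_symplectic_form\<close> is the sum of the \<open>dq\<^sup>i \<and> dp\<^sub>i\<close>.\<close>

lemma canonical_symplectic_form_coordinates:
  fixes B :: "'q::real_normed_vector set"
  assumes B: "finite_dimensional_vector_space (*\<^sub>R) B"
  shows "canonical_symplectic_form z u v =
    (\<Sum>b\<in>B. representation B (fst u) b * blinfun_apply (snd v) b
           - representation B (fst v) b * blinfun_apply (snd u) b)"
proof -
  have "blinfun_apply \<alpha> x = (\<Sum>b\<in>B. representation B x b * blinfun_apply \<alpha> b)"
    for \<alpha> :: "'q \<Rightarrow>\<^sub>L real" and x
    using arg_cong[OF basis_expansion[OF B, of x], of "blinfun_apply \<alpha>"]
    by (simp add: blinfun.sum_right blinfun.scaleR_right)
  from this[of "snd v" "fst u"] this[of "snd u" "fst v"] show ?thesis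
    unfolding canonical_symplectic_form_def sum_subtractf by simp
qed

end

(* The two transforms satisfy the identity (F+)^* omega = (F-)^* omega - d phi: the symmetric Hessian
   of H cancels from the difference of the two pullbacks, leaving only the forces. Pulling this
   identity back along the local inverse of F- gives the evolution formula. *)
theory Submission
  imports Defs
begin

section \<open>Equality of mixed second derivatives\<close>

section \<open>Symmetry of second derivatives\<close>

text \<open>The chain rule along a line reduces directional derivatives to one real variable, where
  the mean value theorem \<open>MVT2\<close> applies.\<close>

lemma has_real_derivative_along_line:
  fixes f :: "'a::real_normed_vector \<Rightarrow> real"
  assumes "f differentiable (at (a + r *\<^sub>R v))"
  shows "((\<lambda>t. f (a + t *\<^sub>R v)) has_real_derivative
    frechet_derivative f (at (a + r *\<^sub>R v)) v) (at r)"
proof -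
  have "((\<lambda>t. a + t *\<^sub>R v) has_derivative (\<lambda>h. h *\<^sub>R v)) (at r)"
    by (auto intro!: derivative_eq_intros)
  from has_derivative_compose[OF this frechet_derivative_works[THEN iffD1, OF assms]]
  have "((\<lambda>t. f (a + t *\<^sub>R v)) has_derivative
    (\<lambda>h. frechet_derivative f (at (a + r *\<^sub>R v)) (h *\<^sub>R v))) (at r)" .
  moreover have "frechet_derivative f (at (a + r *\<^sub>R v)) (h *\<^sub>R v) =
      frechet_derivative f (at (a + r *\<^sub>R v)) v * h" for h
    using linear_scale[OF linear_frechet_derivative[OF assms]] by (simp add: mult.commute)
  ultimately show ?thesis
    by (simp add: has_field_derivative_def)
qed

text \<open>Two applications of the mean value theorem: first in direction \<open>v\<close>, then in
  direction \<open>u\<close> to the derivative along \<open>v\<close>. The left side is symmetric in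
  \<open>u\<close> and \<open>v\<close>, so exchanging them expresses the same number through the
  other mixed derivative.\<close>

lemma second_difference_mean_value:
  fixes f :: "'a::real_normed_vector \<Rightarrow> real"
  assumes f: "\<And>y. y \<in> ball x d \<Longrightarrow> f differentiable (at y)"
    and f': "\<And>y. y \<in> ball x d \<Longrightarrow> (\<lambda>y. frechet_derivative f (at y) v) differentiable (at y)"
    and s: "0 < s" "s * (norm u + norm v) < d"
  obtains y where "y \<in> ball x d"
    "f (x + s *\<^sub>R v + s *\<^sub>R u) - f (x + s *\<^sub>R v) - f (x + s *\<^sub>R u) + f x
      = s * s * frechet_derivative (\<lambda>y. frechet_derivative f (at y) v) (at y) u"
proof -
  \<comment> \<open>The whole parallelogram with corner \<open>x\<close> and sides
    \<open>s u\<close> and \<open>s v\<close> stays in the ball.\<close>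
  have inb: "x + b *\<^sub>R u + t *\<^sub>R v \<in> ball x d"
    if "0 \<le> b" "b \<le> s" "0 \<le> t" "t \<le> s" for b t
  proof -
    have "norm (b *\<^sub>R u + t *\<^sub>R v) \<le> b * norm u + t * norm v"
      using norm_triangle_ineq[of "b *\<^sub>R u" "t *\<^sub>R v"] that by simp
    also have "\<dots> \<le> s * norm u + s * norm v"
      using that by (intro add_mono mult_right_mono) auto
    finally have "norm (b *\<^sub>R u + t *\<^sub>R v) < d"
      using s by (simp add: algebra_simps)
    moreover have "x - (x + b *\<^sub>R u + t *\<^sub>R v) = - (b *\<^sub>R u + t *\<^sub>R v)"
      by simp
    ultimately show ?thesis
      by (simp only: mem_ball dist_norm norm_minus_cancel)
  qed
  \<comment> \<open>\<open>g\<close> compares \<open>f\<close> on two parallel lines in direction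
    \<open>v\<close>, a distance \<open>s u\<close> apart; \<open>g s - g 0\<close> is the second
    difference.\<close>
  define g where "g t = f (x + s *\<^sub>R u + t *\<^sub>R v) - f (x + t *\<^sub>R v)" for t
  let ?f' = "\<lambda>y. frechet_derivative f (at y) v"
  have "(g has_real_derivative ?f' (x + s *\<^sub>R u + t *\<^sub>R v) - ?f' (x + t *\<^sub>R v)) (at t)"
    if "0 \<le> t" "t \<le> s" for t
    unfolding g_def
    using that s(1) inb[of s t] inb[of 0 t]
    by (intro DERIV_diff has_real_derivative_along_line f) auto
  from MVT2[OF s(1) this] obtain t where t: "0 < t" "t < s"
    "g s - g 0 = s * (?f' (x + s *\<^sub>R u + t *\<^sub>R v) - ?f' (x + t *\<^sub>R v))"
    by auto
  \<comment> \<open>With \<open>t\<close> now fixed, the bracket in \<open>t(3)\<close> is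
    \<open>k s - k 0\<close>, an increment in direction \<open>u\<close>.\<close>
  define k where "k b = ?f' (x + t *\<^sub>R v + b *\<^sub>R u)" for b
  have "(k has_real_derivative frechet_derivative ?f' (at (x + t *\<^sub>R v + b *\<^sub>R u)) u) (at b)"
    if "0 \<le> b" "b \<le> s" for b
    unfolding k_def
    using that t inb[of b t]
    by (intro has_real_derivative_along_line f') (auto simp: algebra_simps)
  from MVT2[OF s(1) this] obtain b where b: "0 < b" "b < s"
    "k s - k 0 = s * frechet_derivative ?f' (at (x + t *\<^sub>R v + b *\<^sub>R u)) u"
    by auto
  show ?thesis
  proof
    show "x + t *\<^sub>R v + b *\<^sub>R u \<in> ball x d"
      using inb[of b t] b t by (simp add: algebra_simps)
    have "g s - g 0 = s * (k s - k 0)"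
      using t(3) by (simp add: k_def add.commute add.left_commute)
    then show "f (x + s *\<^sub>R v + s *\<^sub>R u) - f (x + s *\<^sub>R v) - f (x + s *\<^sub>R u) + f x
      = s * s * frechet_derivative ?f' (at (x + t *\<^sub>R v + b *\<^sub>R u)) u"
      unfolding b(3) by (simp add: g_def add.commute add.left_commute mult.assoc)
  qed
qed

text \<open>Schwarz's theorem. Both mixed derivatives, each at some point near \<open>x\<close>,
  equal the same second difference divided by \<open>s * s\<close>; their continuity carries the
  equality over to \<open>x\<close>.\<close>

lemma second_frechet_derivative_symmetric:
  fixes f :: "'a::real_normed_vector \<Rightarrow> real"
  assumes S: "open S" "x \<in> S" and f: "Ck_on 2 S f"
  shows "frechet_derivative (\<lambda>y. frechet_derivative f (at y) v) (at x) u =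
    frechet_derivative (\<lambda>y. frechet_derivative f (at y) u) (at x) v"
proof -
  define D where "D u v y = frechet_derivative (\<lambda>y. frechet_derivative f (at y) v) (at y) u" for u v y
  have d1: "\<And>y. y \<in> S \<Longrightarrow> f differentiable (at y)"
    and d2: "\<And>y v. y \<in> S \<Longrightarrow> (\<lambda>y. frechet_derivative f (at y) v) differentiable (at y)"
    and "\<And>u v. continuous_on S (D u v)"
    using f unfolding D_def by (auto simp: numeral_2_eq_2)
  then have cont: "isCont (D u v) x" for u v
    using S by (simp add: continuous_on_eq_continuous_at)
  have "\<bar>D u v x - D v u x\<bar> \<le> e" if "e > 0" for e
  proof -
    have "\<forall>\<^sub>F y in nhds x. dist (D u v y) (D u v x) < e / 2 \<and> dist (D v u y) (D v u x) < e / 2 \<and> y \<in> S"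
      using that S tendstoD[OF cont[of u v, unfolded isCont_def], of "e / 2"] tendstoD[OF cont[of v u, unfolded isCont_def], of "e / 2"]
      by (intro eventually_conj eventually_nhds_in_open)
        (auto simp: eventually_nhds_conv_at)
    then obtain d where d: "d > 0" and D: "\<And>y. y \<in> ball x d \<Longrightarrow>
      dist (D u v y) (D u v x) < e / 2 \<and> dist (D v u y) (D v u x) < e / 2 \<and> y \<in> S"
      by (auto simp: eventually_nhds_metric dist_commute)
    \<comment> \<open>The summand 1 keeps the denominator positive when \<open>u = v = 0\<close>,
      and it makes \<open>s * (norm u + norm v) = d - s\<close> strictly smaller than
      \<open>d\<close>.\<close>
    define s where "s = d / (norm u + norm v + 1)"
    have pos: "0 < norm u + norm v + 1"
      by (simp add: add_nonneg_pos)
    then have "0 < s" and "s * (norm u + norm v + 1) = d"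
      using d by (simp_all add: s_def)
    then have s: "0 < s" "s * (norm u + norm v) < d"
      by (simp_all add: distrib_left)
    then have s': "s * (norm v + norm u) < d"
      by (simp add: add.commute)
    obtain y where y: "y \<in> ball x d"
      "f (x + s *\<^sub>R v + s *\<^sub>R u) - f (x + s *\<^sub>R v) - f (x + s *\<^sub>R u) + f x = s * s * D u v y"
      using second_difference_mean_value[of x d f v s u] d1 d2 D s unfolding D_def by blast
    obtain y' where y': "y' \<in> ball x d"
      "f (x + s *\<^sub>R u + s *\<^sub>R v) - f (x + s *\<^sub>R u) - f (x + s *\<^sub>R v) + f x = s * s * D v u y'"
      using second_difference_mean_value[of x d f u s v] d1 d2 D s(1) s' unfolding D_def by blast
    have swap: "x + s *\<^sub>R u + s *\<^sub>R v = x + s *\<^sub>R v + s *\<^sub>R u"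
      by simp
    have "s * s * D u v y = s * s * D v u y'"
      using y(2) y'(2)[unfolded swap] by linarith
    then have "D u v y = D v u y'"
      using s(1) by simp
    \<comment> \<open>The common value at \<open>y\<close> and \<open>y'\<close> is within
      \<open>e / 2\<close> of each of the two mixed derivatives at \<open>x\<close>.\<close>
    then show ?thesis
      using D[OF y(1)] D[OF y'(1)] unfolding dist_real_def by linarith
  qed
  then have "\<bar>D u v x - D v u x\<bar> \<le> 0"
    using field_le_epsilon[of "\<bar>D u v x - D v u x\<bar>" 0] by simp
  then have "D u v x = D v u x"
    by simp
  then show ?thesis
    unfolding D_def .
qed

section \<open>The forced discrete Legendre transforms\<close>

lemma smooth_on_imp_differentiable:
  "smooth_on S f \<Longrightarrow> x \<in> S \<Longrightarrow> f differentiable (at x)"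
  unfolding smooth_on_def by (metis Ck_on.simps(2))

lemma smooth_on_imp_frechet_derivative_differentiable:
  "smooth_on S f \<Longrightarrow> x \<in> S \<Longrightarrow> (\<lambda>y. frechet_derivative f (at y) v) differentiable (at x)"
  unfolding smooth_on_def by (metis Ck_on.simps(2))

lemma force_q_apply: "blinfun_apply (force_q \<phi> z) a = blinfun_apply (\<phi> z) (a, 0)"
  unfolding force_q_def
  by (subst bounded_linear_Blinfun_apply) (auto intro!: bounded_linear_intros)

lemma force_p_apply: "blinfun_apply (force_p \<phi> z) \<alpha> = blinfun_apply (\<phi> z) (0, \<alpha>)"
  unfolding force_p_def
  by (subst bounded_linear_Blinfun_apply) (auto intro!: bounded_linear_intros)

text \<open>The chain rule along the inclusion \<open>q \<mapsto> (q, snd z)\<close>; boundedness of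
  the derivative is what allows \<open>Blinfun\<close> to be evaluated. Partial derivatives thereby
  become values of the total derivative of \<open>H\<close>, so that its Hessian can be used as one
  bilinear form.\<close>

lemma partial_D1_apply:
  assumes "H differentiable (at z)"
  shows "blinfun_apply (partial_D1 H z) a = frechet_derivative H (at z) (a, 0)"
proof -
  have H: "(H has_derivative frechet_derivative H (at z)) (at (fst z, snd z))"
    using frechet_derivative_works[THEN iffD1, OF assms] by simp
  have "((\<lambda>q. (q, snd z)) has_derivative (\<lambda>a. (a, 0))) (at (fst z))"
    by (rule has_derivative_Pair[OF has_derivative_ident has_derivative_const])
  from has_derivative_compose[OF this H]
  have d: "((\<lambda>q. H (q, snd z)) has_derivative (\<lambda>a. frechet_derivative H (at z) (a, 0))) (at (fst z))"
    by simp
  show ?thesis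
    unfolding partial_D1_def frechet_derivative_at[OF d, symmetric]
    by (simp add: bounded_linear_Blinfun_apply has_derivative_bounded_linear[OF d])
qed

lemma partial_D2_apply:
  assumes "H differentiable (at z)"
  shows "blinfun_apply (partial_D2 H z) \<alpha> = frechet_derivative H (at z) (0, \<alpha>)"
proof -
  have H: "(H has_derivative frechet_derivative H (at z)) (at (fst z, snd z))"
    using frechet_derivative_works[THEN iffD1, OF assms] by simp
  have "((\<lambda>p. (fst z, p)) has_derivative (\<lambda>\<alpha>. (0, \<alpha>))) (at (snd z))"
    by (rule has_derivative_Pair[OF has_derivative_const has_derivative_ident])
  from has_derivative_compose[OF this H]
  have d: "((\<lambda>p. H (fst z, p)) has_derivative (\<lambda>\<alpha>. frechet_derivative H (at z) (0, \<alpha>))) (at (snd z))"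
    by simp
  show ?thesis
    unfolding partial_D2_def frechet_derivative_at[OF d, symmetric]
    by (simp add: bounded_linear_Blinfun_apply has_derivative_bounded_linear[OF d])
qed

text \<open>Surjectivity of the embedding, due to finite dimension, makes \<open>from_bidual\<close>
  a right inverse. Testing with covectors thus removes \<open>from_bidual\<close>, which never has
  to be differentiated itself.\<close>

lemma apply_from_bidual:
  fixes \<alpha> :: "'q::real_normed_vector \<Rightarrow>\<^sub>L real"
  assumes "finite_dimensional_vector_space (*\<^sub>R) (B :: 'q set)"
  shows "blinfun_apply \<alpha> (from_bidual \<xi>) = blinfun_apply \<xi> \<alpha>"
proof -
  have "bidual_embedding (from_bidual \<xi>) = \<xi>"
    unfolding from_bidual_def using bij_is_surj[OF bij_bidual_embedding[OF assms]] by (rule surj_f_inv_f)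
  then show ?thesis
    using bidual_embedding_apply[of "from_bidual \<xi>" \<alpha>] by simp
qed

section \<open>Derivatives of the Legendre transforms and comparison of their pullbacks\<close>

context
  fixes H :: "'q::real_normed_vector cotangent \<Rightarrow> real" and \<phi> :: "'q cotangent one_form"
  assumes fdhs: "FDHS H \<phi>"
begin

text \<open>Serves both transforms: for \<open>a\<close> of the form \<open>(b, 0)\<close> the
  function is the momentum of \<open>legendre_minus\<close> evaluated at \<open>b\<close>, and for
  \<open>(0, \<alpha>)\<close> it is \<open>\<alpha>\<close> applied to the position of
  \<open>legendre_plus\<close>.\<close>

lemma has_derivative_momentum_component:
  "((\<lambda>z. frechet_derivative H (at z) a - blinfun_apply (\<phi> z) a) has_derivative
    (\<lambda>u. frechet_derivative (\<lambda>z. frechet_derivative H (at z) a) (at w) u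
      - blinfun_apply (frechet_derivative \<phi> (at w) u) a)) (at w)"
proof -
  have "(\<phi> has_derivative frechet_derivative \<phi> (at w)) (at w)"
    and "((\<lambda>z. frechet_derivative H (at z) a) has_derivative
      frechet_derivative (\<lambda>z. frechet_derivative H (at z) a) (at w)) (at w)"
    using fdhs smooth_on_imp_differentiable[of UNIV \<phi> w]
      smooth_on_imp_frechet_derivative_differentiable[of UNIV H w a]
    by (simp_all add: FDHS_def frechet_derivative_works)
  then show ?thesis
    by (intro has_derivative_diff bounded_linear.has_derivative[OF blinfun.bounded_linear_left])
qed

lemma H_differentiable: "H differentiable (at z)"
  using fdhs by (auto simp: FDHS_def intro: smooth_on_imp_differentiable)

text \<open>Each component is differentiated in two ways, through the transform and through its
  explicit formula, and derivatives are unique. The position component is first paired with a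
  covector, which brings it into the form of
  \<open>has_derivative_momentum_component\<close>.\<close>

lemma frechet_derivative_legendre_plus:
  assumes "legendre_plus H \<phi> differentiable (at w)"
  shows "snd (frechet_derivative (legendre_plus H \<phi>) (at w) u) = snd u"
    and "blinfun_apply \<alpha> (fst (frechet_derivative (legendre_plus H \<phi>) (at w) u)) =
      frechet_derivative (\<lambda>z. frechet_derivative H (at z) (0, \<alpha>)) (at w) u
      - blinfun_apply (frechet_derivative \<phi> (at w) u) (0, \<alpha>)"
proof -
  note d = frechet_derivative_works[THEN iffD1, OF assms]
  have "((\<lambda>z. snd (legendre_plus H \<phi> z)) has_derivative
      (\<lambda>u. snd (frechet_derivative (legendre_plus H \<phi>) (at w) u))) (at w)"
    by (intro has_derivative_snd d)
  moreover have "((\<lambda>z. snd (legendre_plus H \<phi> z)) has_derivative snd) (at w)"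
    by (simp add: legendre_plus_def has_derivative_snd[OF has_derivative_ident])
  ultimately show "snd (frechet_derivative (legendre_plus H \<phi>) (at w) u) = snd u"
    by (metis has_derivative_unique)
  obtain B :: "'q set" where B: "finite_dimensional_vector_space (*\<^sub>R) B"
    using fdhs by (auto simp: FDHS_def)
  have deriv: "((\<lambda>z. blinfun_apply \<alpha> (fst (legendre_plus H \<phi> z))) has_derivative
      (\<lambda>u. blinfun_apply \<alpha> (fst (frechet_derivative (legendre_plus H \<phi>) (at w) u)))) (at w)"
    by (intro bounded_linear.has_derivative[OF blinfun.bounded_linear_right] has_derivative_fst d)
  have eq: "(\<lambda>z. blinfun_apply \<alpha> (fst (legendre_plus H \<phi> z))) =
      (\<lambda>z. frechet_derivative H (at z) (0, \<alpha>) - blinfun_apply (\<phi> z) (0, \<alpha>))"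
    by (simp add: legendre_plus_def apply_from_bidual[OF B] blinfun.diff_left
        partial_D2_apply[OF H_differentiable] force_p_apply)
  from has_derivative_unique[OF deriv[unfolded eq] has_derivative_momentum_component]
  show "blinfun_apply \<alpha> (fst (frechet_derivative (legendre_plus H \<phi>) (at w) u)) =
      frechet_derivative (\<lambda>z. frechet_derivative H (at z) (0, \<alpha>)) (at w) u
      - blinfun_apply (frechet_derivative \<phi> (at w) u) (0, \<alpha>)"
    by (rule fun_cong)
qed

text \<open>The same argument with the roles exchanged: position is preserved, and momentum is
  evaluated on vectors, without passing through the bidual.\<close>

lemma frechet_derivative_legendre_minus:
  assumes "legendre_minus H \<phi> differentiable (at w)"
  shows "fst (frechet_derivative (legendre_minus H \<phi>) (at w) u) = fst u"
    and "blinfun_apply (snd (frechet_derivative (legendre_minus H \<phi>) (at w) u)) a =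
      frechet_derivative (\<lambda>z. frechet_derivative H (at z) (a, 0)) (at w) u
      - blinfun_apply (frechet_derivative \<phi> (at w) u) (a, 0)"
proof -
  note d = frechet_derivative_works[THEN iffD1, OF assms]
  have "((\<lambda>z. fst (legendre_minus H \<phi> z)) has_derivative
      (\<lambda>u. fst (frechet_derivative (legendre_minus H \<phi>) (at w) u))) (at w)"
    by (intro has_derivative_fst d)
  moreover have "((\<lambda>z. fst (legendre_minus H \<phi> z)) has_derivative fst) (at w)"
    by (simp add: legendre_minus_def has_derivative_fst[OF has_derivative_ident])
  ultimately show "fst (frechet_derivative (legendre_minus H \<phi>) (at w) u) = fst u"
    by (metis has_derivative_unique)
  have deriv: "((\<lambda>z. blinfun_apply (snd (legendre_minus H \<phi> z)) a) has_derivative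
      (\<lambda>u. blinfun_apply (snd (frechet_derivative (legendre_minus H \<phi>) (at w) u)) a)) (at w)"
    by (intro bounded_linear.has_derivative[OF blinfun.bounded_linear_left] has_derivative_snd d)
  have eq: "(\<lambda>z. blinfun_apply (snd (legendre_minus H \<phi> z)) a) =
      (\<lambda>z. frechet_derivative H (at z) (a, 0) - blinfun_apply (\<phi> z) (a, 0))"
    by (simp add: legendre_minus_def blinfun.diff_left
        partial_D1_apply[OF H_differentiable] force_q_apply)
  from has_derivative_unique[OF deriv[unfolded eq] has_derivative_momentum_component]
  show "blinfun_apply (snd (frechet_derivative (legendre_minus H \<phi>) (at w) u)) a =
      frechet_derivative (\<lambda>z. frechet_derivative H (at z) (a, 0)) (at w) u
      - blinfun_apply (frechet_derivative \<phi> (at w) u) (a, 0)"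
    by (rule fun_cong)
qed

text \<open>The plus transform contributes the momentum slots and the minus transform the position
  slots. In the difference of the pullbacks they combine to \<open>h u v - h v u = 0\<close> for the
  Hessian and to \<open>- ext_deriv \<phi> w u v\<close> for the force.\<close>

lemma pullback_legendre_plus:
  assumes "legendre_plus H \<phi> differentiable (at w)" "legendre_minus H \<phi> differentiable (at w)"
  shows "pullback (legendre_plus H \<phi>) canonical_symplectic_form w u v =
    pullback (legendre_minus H \<phi>) canonical_symplectic_form w u v - ext_deriv \<phi> w u v"
proof -
  define h where "h u v = frechet_derivative (\<lambda>z. frechet_derivative H (at z) v) (at w) u" for u v
  have "Ck_on 2 UNIV H"
    using fdhs by (auto simp: FDHS_def smooth_on_def)
  then have sym: "h u v = h v u" for u v
    unfolding h_def by (intro second_frechet_derivative_symmetric[of UNIV]) auto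
  \<comment> \<open>Linearity is immediate in the outer direction of differentiation; symmetry
    transfers it to the inner one, where the splitting takes place.\<close>
  have "linear (\<lambda>u. h u v)" for v
    using fdhs unfolding h_def FDHS_def
    by (intro linear_frechet_derivative smooth_on_imp_frechet_derivative_differentiable[of UNIV]) auto
  then have h_split: "h u v = h u (fst v, 0) + h u (0, snd v)" for u v
    using linear_add[of "\<lambda>v. h v u" "(fst v, 0)" "(0, snd v)"] by (simp add: sym[of u])
  have \<phi>_split: "blinfun_apply A v = blinfun_apply A (fst v, 0) + blinfun_apply A (0, snd v)"
    for A :: "'q cotangent \<Rightarrow>\<^sub>L real" and v
    using blinfun.add_right[of A "(fst v, 0)" "(0, snd v)"] by simp
  show ?thesis
    using sym[of u v] h_split[of u v] h_split[of v u]
      \<phi>_split[of "frechet_derivative \<phi> (at w) u" v] \<phi>_split[of "frechet_derivative \<phi> (at w) v" u]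
    unfolding pullback_def canonical_symplectic_form_def ext_deriv_def
      frechet_derivative_legendre_plus[OF assms(1)] frechet_derivative_legendre_minus[OF assms(2)]
    by (simp add: h_def)
qed

end

section \<open>Pullback along the local inverse\<close>

lemma pullback_compose:
  assumes "g differentiable (at z)" "f differentiable (at (g z))"
  shows "pullback (f \<circ> g) \<omega> z u v = pullback g (pullback f \<omega>) z u v"
  unfolding pullback_def by (simp add: frechet_derivative_compose[OF assms])

text \<open>Intended for a map composed with its \<open>inv_into\<close>, which is known to be the
  identity only on the open image; the derivative there depends on nothing else.\<close>

lemma frechet_derivative_eq_id_on_open:
  assumes "open U" "z \<in> U" "\<And>y. y \<in> U \<Longrightarrow> f y = y"
  shows "frechet_derivative f (at z) = id"
proof -
  have "(f has_derivative (\<lambda>u. u)) (at z)"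
    by (rule has_derivative_transform_within_open[OF has_derivative_ident assms(1,2)])
      (simp add: assms(3))
  then show ?thesis
    unfolding id_def by (rule frechet_derivative_at[symmetric])
qed

theorem proposition4p10:
  fixes H :: "'q::real_normed_vector cotangent \<Rightarrow> real"
    and \<phi> :: "'q cotangent one_form"
    and U V W :: "'q cotangent set"
  assumes "regular_FDHS H \<phi>"
    and "diffeomorphism_on W U (legendre_minus H \<phi>)"
    and "diffeomorphism_on W V (legendre_plus H \<phi>)"
  shows "\<forall>z\<in>U. \<forall>u v.
    pullback (discrete_flow H \<phi> W) canonical_symplectic_form z u v =
      canonical_symplectic_form z u v
      - pullback (inv_into W (legendre_minus H \<phi>)) (ext_deriv \<phi>) z u v"
proof (intro ballI allI)
  fix z u v assume z: "z \<in> U"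
  let ?Fm = "legendre_minus H \<phi>" and ?Fp = "legendre_plus H \<phi>"
  define G where "G = inv_into W ?Fm"
  have fdhs: "FDHS H \<phi>"
    using assms(1) by (simp add: regular_FDHS_def)
  have bij: "bij_betw ?Fm W U" and U: "open U"
    using assms(2) by (auto simp: diffeomorphism_on_def)
  have FG: "?Fm (G y) = y" if "y \<in> U" for y
    unfolding G_def using bij that by (rule bij_betw_inv_into_right)
  have "G z \<in> W"
    unfolding G_def using bij z by (metis bij_betw_def inv_into_into)
  then have Fm: "?Fm differentiable (at (G z))" and Fp: "?Fp differentiable (at (G z))"
    and G: "G differentiable (at z)"
    using assms(2,3) z smooth_on_imp_differentiable unfolding diffeomorphism_on_def G_def by blast+
  have "pullback (discrete_flow H \<phi> W) canonical_symplectic_form z u v =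
      pullback G (pullback ?Fp canonical_symplectic_form) z u v"
    unfolding discrete_flow_def G_def[symmetric] by (rule pullback_compose[OF G Fp])
  \<comment> \<open>The identity between the transforms is used at the point \<open>G z\<close>, on
    the images of \<open>u\<close> and \<open>v\<close> under the derivative of \<open>G\<close>;
    only the pullbacks along \<open>G\<close> are unfolded.\<close>
  also have "\<dots> = pullback G (pullback ?Fm canonical_symplectic_form) z u v - pullback G (ext_deriv \<phi>) z u v"
    using pullback_legendre_plus[OF fdhs Fp Fm] by (simp add: pullback_def[of G])
  also have "pullback G (pullback ?Fm canonical_symplectic_form) z u v =
      pullback (?Fm \<circ> G) canonical_symplectic_form z u v"
    by (rule pullback_compose[OF G Fm, symmetric])
  also have "\<dots> = canonical_symplectic_form z u v"
    using frechet_derivative_eq_id_on_open[OF U z, of "?Fm \<circ> G"] FG z by (simp add: pullback_def)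
  finally show "pullback (discrete_flow H \<phi> W) canonical_symplectic_form z u v =
      canonical_symplectic_form z u v - pullback (inv_into W ?Fm) (ext_deriv \<phi>) z u v"
    unfolding G_def .
qed

end
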